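(* Let $T$ be a random load vector in $\mathbb{R}^N_{\ge0}$, let $\mathcal{A}_E=\{a\in\mathbb{R}^N: a\ge0,\ \mathbf{1}^\top a=E\}$ be the simplex of feasible actions with budget $E$, and let the task loss be $\ell(t,a)=f(t,a)-f(t,\phi^*(t))$, where $f(t,a)=\|t+a\|^2$ and $\phi^*(t)$ is the minimizer of $f(t,\cdot)$ over $\mathcal{A}_E$. Consider $K$-level quantizers, consisting of a measurable partition $\{\mathcal{C}_1,\dots,\mathcal{C}_K\}$ of load space with $\Pr(T\in\mathcal{C}_k)>0$ and actions $a_1,\dots,a_K\in\mathcal{A}_E$, and the two updates: (1) action update: for the given cells, set $a_k=\operatorname{WF}_E(\mu_k)=(\lambda_k\mathbf{1}-\mu_k)^+$ with $\mu_k=\mathbb{E}[T\mid T\in\mathcal{C}_k]$; (2) encoder update: for the given actions, assign each $t$ to any index $k$ that minimizes $2t^\top a_k+\|a_k\|^2$. Alternating (1) and (2) cannot increase the expected task distortion, because each update exactly minimizes it with the other block (cells or actions) fixed. As with ordinary Lloyd iteration, this establishes monotone descent to a coordinatewise optimum, not global optimality from arbitrary initialization.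
   Context: $\|\cdot\|$ is the Euclidean norm, $\mathbf{1}$ is the all-ones vector, vector inequalities are coordinatewise, and $x^+$ is the coordinatewise positive part. Load space is the space of load vectors $t$. Water-filling: $\operatorname{WF}_E(x)=(\lambda\mathbf{1}-x)^+$, where $\lambda=\lambda(x)$ makes the coordinates sum to $E$; $\lambda_k$ denotes $\lambda(\mu_k)$, and $\phi^*(t)=\operatorname{WF}_E(t)$. The expected task distortion of a quantizer is $\mathbb{E}[\ell(T,a_{c(T)})]$, where $c(t)=k$ for $t\in\mathcal{C}_k$. A coordinatewise optimum is a pair (cells, actions) in which each block is optimal given the other. *)

theory Defs
  imports "HOL-Probability.Probability"
begin

definition load_space :: "(real ^ 'n) set" where
  "load_space = {t. \<forall>i. 0 \<le> t $ i}"

(* The first moment is what makes the conditional means E[T | T in C] exist; it also suffices for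
   the task loss to be integrable, because the quadratic terms in t cancel in the loss. *)
definition random_load_vector :: "'b measure \<Rightarrow> ('b \<Rightarrow> real ^ 'n) \<Rightarrow> bool" where
  "random_load_vector M T \<longleftrightarrow>
     prob_space M \<and> T \<in> borel_measurable M \<and> (\<forall>\<omega>\<in>space M. T \<omega> \<in> load_space) \<and> integrable M T"

definition action_simplex :: "real \<Rightarrow> (real ^ 'n) set" where
  "action_simplex E = {a. (\<forall>i. 0 \<le> a $ i) \<and> (\<Sum>i\<in>UNIV. a $ i) = E}"

definition cost :: "real ^ 'n \<Rightarrow> real ^ 'n \<Rightarrow> real" where
  "cost t a = (norm (t + a))\<^sup>2"

definition opt_action :: "real \<Rightarrow> real ^ 'n \<Rightarrow> real ^ 'n" where
  "opt_action E t = (THE a. is_arg_min (cost t) (\<lambda>b. b \<in> action_simplex E) a)"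

definition task_loss :: "real \<Rightarrow> real ^ 'n \<Rightarrow> real ^ 'n \<Rightarrow> real" where
  "task_loss E t a = cost t a - cost t (opt_action E t)"

(* The level is unique for E > 0. For E = 0 it is not, but every choice gives the same
   water-filling vector 0, hence SOME rather than THE. *)
definition water_level :: "real \<Rightarrow> real ^ 'n \<Rightarrow> real" where
  "water_level E x = (SOME l. (\<Sum>i\<in>UNIV. max 0 (l - x $ i)) = E)"

definition water_fill :: "real \<Rightarrow> real ^ 'n \<Rightarrow> real ^ 'n" where
  "water_fill E x = (\<chi> i. max 0 (water_level E x - x $ i))"

definition measurable_partition :: "nat \<Rightarrow> (nat \<Rightarrow> (real ^ 'n) set) \<Rightarrow> bool" where
  "measurable_partition K C \<longleftrightarrow>
     (\<forall>k\<in>{1..K}. C k \<in> sets borel) \<and> disjoint_family_on C {1..K} \<and> (\<Union>k\<in>{1..K}. C k) = load_space"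

definition feasible_actions :: "real \<Rightarrow> nat \<Rightarrow> (nat \<Rightarrow> real ^ 'n) \<Rightarrow> bool" where
  "feasible_actions E K a \<longleftrightarrow> (\<forall>k\<in>{1..K}. a k \<in> action_simplex E)"

definition cell_event :: "'b measure \<Rightarrow> ('b \<Rightarrow> real ^ 'n) \<Rightarrow> (real ^ 'n) set \<Rightarrow> 'b set" where
  "cell_event M T A = {\<omega> \<in> space M. T \<omega> \<in> A}"

definition quantizer_cells ::
    "'b measure \<Rightarrow> ('b \<Rightarrow> real ^ 'n) \<Rightarrow> nat \<Rightarrow> (nat \<Rightarrow> (real ^ 'n) set) \<Rightarrow> bool" where
  "quantizer_cells M T K C \<longleftrightarrow>
     measurable_partition K C \<and> (\<forall>k\<in>{1..K}. measure M (cell_event M T (C k)) > 0)"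

definition quantizer ::
    "'b measure \<Rightarrow> ('b \<Rightarrow> real ^ 'n) \<Rightarrow> real \<Rightarrow> nat \<Rightarrow>
     (nat \<Rightarrow> (real ^ 'n) set) \<Rightarrow> (nat \<Rightarrow> real ^ 'n) \<Rightarrow> bool" where
  "quantizer M T E K C a \<longleftrightarrow> quantizer_cells M T K C \<and> feasible_actions E K a"

definition cell_index :: "nat \<Rightarrow> (nat \<Rightarrow> (real ^ 'n) set) \<Rightarrow> real ^ 'n \<Rightarrow> nat" where
  "cell_index K C t = (THE k. k \<in> {1..K} \<and> t \<in> C k)"

definition distortion ::
    "'b measure \<Rightarrow> ('b \<Rightarrow> real ^ 'n) \<Rightarrow> real \<Rightarrow> nat \<Rightarrow>
     (nat \<Rightarrow> (real ^ 'n) set) \<Rightarrow> (nat \<Rightarrow> real ^ 'n) \<Rightarrow> real" where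
  "distortion M T E K C a = (LINT \<omega>|M. task_loss E (T \<omega>) (a (cell_index K C (T \<omega>))))"

definition cell_mean ::
    "'b measure \<Rightarrow> ('b \<Rightarrow> real ^ 'n) \<Rightarrow> (real ^ 'n) set \<Rightarrow> real ^ 'n" where
  "cell_mean M T A =
     (1 / measure M (cell_event M T A)) *\<^sub>R (LINT \<omega>:cell_event M T A|M. T \<omega>)"

definition action_update ::
    "'b measure \<Rightarrow> ('b \<Rightarrow> real ^ 'n) \<Rightarrow> real \<Rightarrow> (nat \<Rightarrow> (real ^ 'n) set) \<Rightarrow> nat \<Rightarrow> real ^ 'n" where
  "action_update M T E C k = water_fill E (cell_mean M T (C k))"

(* A relation rather than a function: ties may be broken in any measurable way. Cells of
   probability zero, even empty ones, may result. *)
definition encoder_update ::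
    "nat \<Rightarrow> (nat \<Rightarrow> real ^ 'n) \<Rightarrow> (nat \<Rightarrow> (real ^ 'n) set) \<Rightarrow> bool" where
  "encoder_update K a C \<longleftrightarrow>
     measurable_partition K C \<and>
     (\<forall>k\<in>{1..K}. \<forall>t\<in>C k. is_arg_min (\<lambda>j. 2 * (t \<bullet> a j) + (norm (a j))\<^sup>2) (\<lambda>j. j \<in> {1..K}) k)"

(* Competing partitions are not required to have cells of positive probability, so this is the
   stronger reading of optimality of the cells. *)
definition coordinatewise_optimum ::
    "'b measure \<Rightarrow> ('b \<Rightarrow> real ^ 'n) \<Rightarrow> real \<Rightarrow> nat \<Rightarrow>
     (nat \<Rightarrow> (real ^ 'n) set) \<Rightarrow> (nat \<Rightarrow> real ^ 'n) \<Rightarrow> bool" where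
  "coordinatewise_optimum M T E K C a \<longleftrightarrow>
     quantizer M T E K C a \<and>
     (\<forall>b. feasible_actions E K b \<longrightarrow> distortion M T E K C a \<le> distortion M T E K C b) \<and>
     (\<forall>D. measurable_partition K D \<longrightarrow> distortion M T E K C a \<le> distortion M T E K D a)"

(* One round is the action update followed by the encoder update. Every iterate has to be a
   quantizer, since the conditional mean of a cell of probability zero is undefined. *)
definition alternating_run ::
    "'b measure \<Rightarrow> ('b \<Rightarrow> real ^ 'n) \<Rightarrow> real \<Rightarrow> nat \<Rightarrow>
     (nat \<Rightarrow> nat \<Rightarrow> (real ^ 'n) set) \<Rightarrow> (nat \<Rightarrow> nat \<Rightarrow> real ^ 'n) \<Rightarrow> bool" where
  "alternating_run M T E K C a \<longleftrightarrow>
     (\<forall>n. quantizer M T E K (C n) (a n)) \<and>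
     (\<forall>n. \<forall>k\<in>{1..K}. a (Suc n) k = action_update M T E (C n) k) \<and>
     (\<forall>n. encoder_update K (a (Suc n)) (C (Suc n)))"

end

theory Submission
  imports Defs
begin

text \<open>The term \<open>\<parallel>t\<parallel>\<^sup>2\<close> cancels in the task loss, which leaves \<open>2 t\<bullet>a + \<parallel>a\<parallel>\<^sup>2\<close> minus a function of \<open>t\<close>
  alone. For fixed cells this is affine in \<open>t\<close>, so the distortion sees a cell only through its
  probability and first moment, and water-filling the conditional mean is the unique minimizer, with
  a quadratic gap. For fixed actions the encoder update minimizes the integrand pointwise. The gap
  in round \<open>n\<close> is at most the decrease of the distortion, hence tends to zero; together with
  continuity of the distortion in probabilities, moments and actions this makes every limit point
  coordinatewise optimal.\<close>

section \<open>Water-filling\<close>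

text \<open>Intermediate value theorem: the sum vanishes at \<open>- norm x\<close>, and at
  \<open>norm x + E\<close> a single coordinate already contributes at least
  \<open>E\<close>.\<close>

lemma water_level_exists:
  fixes x :: "real ^ 'n"
  assumes "0 \<le> E"
  shows "\<exists>l. (\<Sum>i\<in>UNIV. max 0 (l - x $ i)) = E"
proof -
  let ?h = "\<lambda>l. \<Sum>i\<in>UNIV. max 0 (l - x $ i)"
  have bd: "\<bar>x $ i\<bar> \<le> norm x" for i
    by (rule component_le_norm_cart)
  have "max 0 (- norm x - x $ i) = 0" for i
    using bd[of i] by (auto simp: max_def)
  then have lo: "?h (- norm x) = 0"
    by simp
  \<comment> \<open>\<open>undefined\<close> stands for an arbitrary coordinate; one exists because
    index types are nonempty.\<close>
  have "E \<le> max 0 (norm x + E - x $ undefined)"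
    using bd[of undefined] by (auto simp: max_def)
  also have "\<dots> \<le> ?h (norm x + E)"
    by (rule member_le_sum) auto
  finally have hi: "E \<le> ?h (norm x + E)" .
  have "\<exists>l\<ge>- norm x. l \<le> norm x + E \<and> ?h l = E"
  proof (rule IVT')
    show "- norm x \<le> norm x + E"
      using assms norm_ge_zero[of x] by linarith
  qed (use lo hi assms in \<open>auto intro!: continuous_intros\<close>)
  then show ?thesis
    by blast
qed

lemma water_level_sum:
  fixes x :: "real ^ 'n"
  assumes "0 \<le> E"
  shows "(\<Sum>i\<in>UNIV. max 0 (water_level E x - x $ i)) = E"
  unfolding water_level_def by (rule someI_ex[OF water_level_exists[OF assms]])

lemma water_fill_in_action_simplex:
  assumes "0 \<le> E"
  shows "water_fill E x \<in> action_simplex E"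
  using water_level_sum[OF assms, of x] by (simp add: action_simplex_def water_fill_def)

text \<open>The variational inequality behind the bound: \<open>x + w \<ge> \<lambda>\<close> coordinatewise, with equality
  wherever \<open>w > 0\<close>, while \<open>b - w\<close> has coordinate sum zero.\<close>

lemma cost_water_fill_strongly_minimal:
  assumes "0 \<le> E" and b: "b \<in> action_simplex E"
  shows "cost x (water_fill E x) + (norm (b - water_fill E x))\<^sup>2 \<le> cost x b"
proof -
  define w l where "w = water_fill E x" and "l = water_level E x"
  have w: "w $ i = max 0 (l - x $ i)" for i
    by (simp add: w_def l_def water_fill_def)
  have "w \<in> action_simplex E"
    using water_fill_in_action_simplex[OF assms(1)] by (simp add: w_def)
  with b have "(\<Sum>i\<in>UNIV. l * (b $ i - w $ i)) = 0"
    by (simp add: sum_distrib_left[symmetric] sum_subtractf action_simplex_def)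
  moreover have "l * (b $ i - w $ i) \<le> (x $ i + w $ i) * (b $ i - w $ i)" for i
  proof -
    have "0 \<le> b $ i"
      using b by (simp add: action_simplex_def)
    then show ?thesis
      by (cases "l \<ge> x $ i") (auto simp: w max_def intro: mult_right_mono)
  qed
  ultimately have "0 \<le> (\<Sum>i\<in>UNIV. (x $ i + w $ i) * (b $ i - w $ i))"
    by (metis (no_types, lifting) sum_mono)
  also have "\<dots> = (x + w) \<bullet> (b - w)"
    by (simp add: inner_vec_def)
  finally have "0 \<le> (x + w) \<bullet> (b - w)" .
  moreover have "cost x b = cost x w + (norm (b - w))\<^sup>2 + 2 * ((x + w) \<bullet> (b - w))"
    by (simp add: cost_def power2_norm_eq_inner inner_add_left inner_add_right
        inner_diff_left inner_diff_right inner_commute algebra_simps)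
  ultimately show ?thesis
    by (simp add: w_def)
qed

text \<open>The quadratic gap yields minimality and uniqueness at once, so the definite description
  in \<open>opt_action\<close> really denotes the minimizer.\<close>

lemma opt_action_eq_water_fill:
  fixes t :: "real ^ 'n"
  assumes "0 \<le> E"
  shows "opt_action E t = water_fill E t"
  unfolding opt_action_def
proof (rule the_equality)
  let ?w = "water_fill E t"
  note strong = cost_water_fill_strongly_minimal[OF assms]
  show "is_arg_min (cost t) (\<lambda>b. b \<in> action_simplex E) ?w"
    unfolding is_arg_min_linorder
  proof (intro conjI allI impI)
    show "?w \<in> action_simplex E"
      by (rule water_fill_in_action_simplex[OF assms])
    fix b :: "real ^ 'n"
    assume "b \<in> action_simplex E"
    from strong[OF this, of t] zero_le_power2[of "norm (b - ?w)"] show "cost t ?w \<le> cost t b"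
      by linarith
  qed
  fix a
  assume "is_arg_min (cost t) (\<lambda>b. b \<in> action_simplex E) a"
  then have "cost t a \<le> cost t ?w" "cost t ?w + (norm (a - ?w))\<^sup>2 \<le> cost t a"
    using water_fill_in_action_simplex[OF assms] strong by (auto simp: is_arg_min_linorder)
  then have "(norm (a - ?w))\<^sup>2 \<le> 0"
    by linarith
  then show "a = ?w"
    by simp
qed

section \<open>The distortion in terms of the cell moments\<close>

text \<open>The action-dependent part of \<open>cost\<close>, and at the same time the objective of
  the encoder update. Being affine in \<open>t\<close>, it calls only for first moments.\<close>

definition action_cost :: "real ^ 'n \<Rightarrow> real ^ 'n \<Rightarrow> real" where
  "action_cost t a = 2 * (t \<bullet> a) + (norm a)\<^sup>2"

text \<open>Left unnormalized, unlike \<open>cell_mean\<close>, so that it makes sense for cells of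
  probability zero and varies continuously with the cell.\<close>

definition cell_moment :: "'b measure \<Rightarrow> ('b \<Rightarrow> real ^ 'n) \<Rightarrow> (real ^ 'n) set \<Rightarrow> real ^ 'n" where
  "cell_moment M T A = (LINT \<omega>:cell_event M T A|M. T \<omega>)"

lemma cost_eq_action_cost: "cost t a = (norm t)\<^sup>2 + action_cost t a"
  by (simp add: cost_def action_cost_def power2_norm_eq_inner inner_add_left inner_add_right
      inner_commute)

lemma task_loss_eq:
  "task_loss E t a = action_cost t a - action_cost t (opt_action E t)"
  by (simp add: task_loss_def cost_eq_action_cost)

lemma norm_le_budget:
  assumes "a \<in> action_simplex E"
  shows "norm a \<le> E"
proof -
  have "norm a \<le> (\<Sum>i\<in>UNIV. \<bar>a $ i\<bar>)"
    by (rule norm_le_l1_cart)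
  also have "\<dots> = E"
    using assms by (simp add: action_simplex_def)
  finally show ?thesis .
qed

lemma action_cost_water_fill_strongly_minimal:
  assumes "0 \<le> E" and "b \<in> action_simplex E"
  shows "action_cost x (water_fill E x) + (norm (b - water_fill E x))\<^sup>2 \<le> action_cost x b"
  using cost_water_fill_strongly_minimal[OF assms, of x] by (simp add: cost_eq_action_cost)

lemma action_cost_opt_action_le:
  assumes "0 \<le> E" and "b \<in> action_simplex E"
  shows "action_cost x (opt_action E x) \<le> action_cost x b"
  unfolding opt_action_eq_water_fill[OF assms(1)]
  using action_cost_water_fill_strongly_minimal[OF assms, of x]
    zero_le_power2[of "norm (b - water_fill E x)"]
  by linarith

lemma opt_action_in_action_simplex:
  assumes "0 \<le> E"
  shows "opt_action E x \<in> action_simplex E"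
  using assms by (simp add: opt_action_eq_water_fill water_fill_in_action_simplex)

text \<open>The growth in \<open>t\<close> is linear, so a finite first moment gives
  integrability.\<close>

lemma abs_action_cost_le:
  assumes "a \<in> action_simplex E"
  shows "\<bar>action_cost t a\<bar> \<le> 2 * E * norm t + E\<^sup>2"
proof -
  have n: "norm a \<le> E"
    by (rule norm_le_budget[OF assms])
  have "\<bar>t \<bullet> a\<bar> \<le> norm t * norm a"
    by (rule Cauchy_Schwarz_ineq2)
  also have "\<dots> \<le> norm t * E"
    by (intro mult_left_mono n) auto
  finally have "\<bar>t \<bullet> a\<bar> \<le> E * norm t"
    by (simp add: mult.commute)
  moreover have "(norm a)\<^sup>2 \<le> E\<^sup>2"
    by (intro power_mono n) auto
  ultimately show ?thesis
    using zero_le_power2[of "norm a"] unfolding action_cost_def abs_le_iff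
    by linarith
qed

text \<open>The optimal value is a minimum of functions of the load that are
  \<open>2 * E\<close>-Lipschitz: testing \<open>s\<close> with the action optimal for
  \<open>t\<close> gives one direction, symmetry the other. The resulting continuity gives
  measurability without any study of the choice made in \<open>water_level\<close>.\<close>

lemma lipschitz_optimal_action_cost:
  fixes s t :: "real ^ 'n"
  assumes "0 \<le> E"
  shows "\<bar>action_cost s (opt_action E s) - action_cost t (opt_action E t)\<bar> \<le> 2 * E * norm (s - t)"
proof -
  have one_sided: "action_cost s (opt_action E s) - action_cost t (opt_action E t)
      \<le> 2 * E * norm (s - t)" for s t :: "real ^ 'n"
  proof -
    let ?a = "opt_action E t"
    have a: "?a \<in> action_simplex E"
      by (rule opt_action_in_action_simplex[OF assms])
    have "action_cost s (opt_action E s) - action_cost t ?a \<le> action_cost s ?a - action_cost t ?a"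
      using action_cost_opt_action_le[OF assms a] by simp
    also have "\<dots> = 2 * ((s - t) \<bullet> ?a)"
      by (simp add: action_cost_def inner_diff_left)
    also have "(s - t) \<bullet> ?a \<le> norm (s - t) * norm ?a"
      by (rule norm_cauchy_schwarz)
    also have "\<dots> \<le> norm (s - t) * E"
      by (intro mult_left_mono norm_le_budget[OF a]) auto
    finally show ?thesis
      by (simp add: mult_ac)
  qed
  show ?thesis
    using one_sided[of s t] one_sided[of t s] by (simp add: norm_minus_commute)
qed

lemma optimal_action_cost_measurable:
  assumes "0 \<le> E"
  shows "(\<lambda>t :: real ^ 'n. action_cost t (opt_action E t)) \<in> borel_measurable borel"
proof (rule borel_measurable_continuous_onI)
  have "(2 * E)-lipschitz_on UNIV (\<lambda>t :: real ^ 'n. action_cost t (opt_action E t))"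
    using assms lipschitz_optimal_action_cost[OF assms]
    by (intro lipschitz_onI) (auto simp: dist_norm)
  then show "continuous_on UNIV (\<lambda>t :: real ^ 'n. action_cost t (opt_action E t))"
    by (rule lipschitz_on_continuous_on)
qed

lemma optimal_action_cost_integrable:
  assumes load: "random_load_vector M T" and "0 \<le> E"
  shows "integrable M (\<lambda>\<omega>. action_cost (T \<omega>) (opt_action E (T \<omega>)))"
proof -
  interpret prob_space M
    using load by (simp add: random_load_vector_def)
  have T: "T \<in> borel_measurable M" "integrable M T"
    using load by (simp_all add: random_load_vector_def)
  show ?thesis
  proof (rule Bochner_Integration.integrable_bound)
    show "integrable M (\<lambda>\<omega>. 2 * E * norm (T \<omega>) + E\<^sup>2)"
      using T by simp
    show "(\<lambda>\<omega>. action_cost (T \<omega>) (opt_action E (T \<omega>))) \<in> borel_measurable M"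
      using measurable_compose[OF T(1) optimal_action_cost_measurable[OF assms(2)]] .
    show "AE \<omega> in M. norm (action_cost (T \<omega>) (opt_action E (T \<omega>)))
        \<le> norm (2 * E * norm (T \<omega>) + E\<^sup>2)"
      unfolding real_norm_def
      by (intro AE_I2 order_trans[OF abs_action_cost_le abs_ge_self]
          opt_action_in_action_simplex[OF assms(2)])
  qed
qed

section \<open>Cell indices and reduction of integrals to cell moments\<close>

lemma cell_index_eq:
  assumes "measurable_partition K C" "k \<in> {1..K}" "t \<in> C k"
  shows "cell_index K C t = k"
  unfolding cell_index_def
proof (rule the_equality)
  fix j
  assume "j \<in> {1..K} \<and> t \<in> C j"
  with assms show "j = k"
    unfolding measurable_partition_def by (auto dest: disjoint_family_onD)
qed (use assms in simp)

lemma cell_index_mem: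
  assumes "measurable_partition K C" "t \<in> load_space"
  shows "cell_index K C t \<in> {1..K}" "t \<in> C (cell_index K C t)"
proof -
  obtain k where "k \<in> {1..K}" "t \<in> C k"
    using assms unfolding measurable_partition_def by blast
  with cell_index_eq[OF assms(1) this]
  show "cell_index K C t \<in> {1..K}" "t \<in> C (cell_index K C t)"
    by simp_all
qed

lemma cell_event_sets:
  assumes "T \<in> borel_measurable M" "A \<in> sets borel"
  shows "cell_event M T A \<in> sets M"
  using measurable_sets[OF assms] by (simp add: cell_event_def vimage_def Int_def conj_commute)

text \<open>Exactly one cell contains the load, so the selected index can be traded for a sum of
  indicators. Each indicator scales \<open>T \<omega>\<close> inside the inner product, so that
  integration produces \<open>cell_moment\<close>.\<close>

lemma action_cost_cell_index:
  assumes C: "measurable_partition K C" and \<omega>: "\<omega> \<in> space M" "T \<omega> \<in> load_space"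
  shows "action_cost (T \<omega>) (a (cell_index K C (T \<omega>))) =
    (\<Sum>k\<in>{1..K}. 2 * ((indicator (cell_event M T (C k)) \<omega> *\<^sub>R T \<omega>) \<bullet> a k)
      + indicator (cell_event M T (C k)) \<omega> * (norm (a k))\<^sup>2)"
proof -
  let ?c = "cell_index K C (T \<omega>)"
  have c: "?c \<in> {1..K}" "T \<omega> \<in> C ?c"
    using cell_index_mem[OF C \<omega>(2)] by auto
  have "indicator (cell_event M T (C k)) \<omega> = (if k = ?c then 1 else 0 :: real)" if "k \<in> {1..K}" for k
  proof (cases "k = ?c")
    case True
    with c(2) \<omega>(1) show ?thesis
      by (metis (no_types, lifting) cell_event_def indicator_simps(1) mem_Collect_eq)
  next
    case False
    then have "T \<omega> \<notin> C k"
      using cell_index_eq[OF C that] by metis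
    with False show ?thesis
      by (simp add: cell_event_def)
  qed
  then have "(\<Sum>k\<in>{1..K}. 2 * ((indicator (cell_event M T (C k)) \<omega> *\<^sub>R T \<omega>) \<bullet> a k)
      + indicator (cell_event M T (C k)) \<omega> * (norm (a k))\<^sup>2)
    = (\<Sum>k\<in>{1..K}. if k = ?c then action_cost (T \<omega>) (a k) else 0)"
    by (intro sum.cong) (auto simp: action_cost_def)
  also have "\<dots> = action_cost (T \<omega>) (a ?c)"
    using c(1) by (simp only: sum.delta finite_atLeastAtMost if_True)
  finally show ?thesis ..
qed

lemma action_cost_cell_index_integral:
  assumes load: "random_load_vector M T" and C: "measurable_partition K C"
  shows "integrable M (\<lambda>\<omega>. action_cost (T \<omega>) (a (cell_index K C (T \<omega>))))"
    and "(LINT \<omega>|M. action_cost (T \<omega>) (a (cell_index K C (T \<omega>)))) =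
      (\<Sum>k\<in>{1..K}. 2 * (cell_moment M T (C k) \<bullet> a k)
        + measure M (cell_event M T (C k)) * (norm (a k))\<^sup>2)"
proof -
  interpret prob_space M
    using load by (simp add: random_load_vector_def)
  have T: "T \<in> borel_measurable M" "integrable M T" "\<And>\<omega>. \<omega> \<in> space M \<Longrightarrow> T \<omega> \<in> load_space"
    using load by (simp_all add: random_load_vector_def)
  let ?I = "\<lambda>k \<omega>. indicator (cell_event M T (C k)) \<omega>"
  let ?f = "\<lambda>k \<omega>. 2 * ((?I k \<omega> *\<^sub>R T \<omega>) \<bullet> a k) + ?I k \<omega> * (norm (a k))\<^sup>2"
  have A: "cell_event M T (C k) \<in> sets M" if "k \<in> {1..K}" for k
    using that C cell_event_sets[OF T(1)] by (simp add: measurable_partition_def)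
  have f: "integrable M (?f k)" "(LINT \<omega>|M. ?f k \<omega>) = 2 * (cell_moment M T (C k) \<bullet> a k)
        + measure M (cell_event M T (C k)) * (norm (a k))\<^sup>2" if "k \<in> {1..K}" for k
  proof -
    have IT: "integrable M (\<lambda>\<omega>. ?I k \<omega> *\<^sub>R T \<omega>)"
      by (rule integrable_mult_indicator[OF A[OF that] T(2)])
    have I: "integrable M (?I k :: _ \<Rightarrow> real)"
      using A[OF that] by (simp add: integrable_indicator_iff emeasure_eq_measure)
    have l: "integrable M (\<lambda>\<omega>. 2 * ((?I k \<omega> *\<^sub>R T \<omega>) \<bullet> a k))"
      by (intro integrable_mult_right integrable_inner_left IT)
    have r: "integrable M (\<lambda>\<omega>. ?I k \<omega> * (norm (a k))\<^sup>2)"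
      by (intro integrable_mult_left I)
    show "integrable M (?f k)"
      by (intro Bochner_Integration.integrable_add l r)
    have "(LINT \<omega>|M. ?f k \<omega>) = 2 * ((LINT \<omega>|M. ?I k \<omega> *\<^sub>R T \<omega>) \<bullet> a k)
        + (LINT \<omega>|M. ?I k \<omega>) * (norm (a k))\<^sup>2"
      using integral_inner_left[OF IT, of "a k"] 
      by (simp only: Bochner_Integration.integral_add[OF l r] integral_mult_right_zero
          integral_mult_left_zero)
    then show "(LINT \<omega>|M. ?f k \<omega>) = 2 * (cell_moment M T (C k) \<bullet> a k)
        + measure M (cell_event M T (C k)) * (norm (a k))\<^sup>2"
      using A[OF that] by (simp add: cell_moment_def set_lebesgue_integral_def)
  qed
  have eq: "action_cost (T \<omega>) (a (cell_index K C (T \<omega>))) = (\<Sum>k\<in>{1..K}. ?f k \<omega>)"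
    if "\<omega> \<in> space M" for \<omega>
    by (rule action_cost_cell_index[where M = M and T = T and \<omega> = \<omega> and a = a, OF C that T(3)[OF that]])
  show "integrable M (\<lambda>\<omega>. action_cost (T \<omega>) (a (cell_index K C (T \<omega>))))"
    by (subst Bochner_Integration.integrable_cong[OF refl eq])
      (auto intro!: Bochner_Integration.integrable_sum f(1) simp del: inner_scaleR_left)
  have "(LINT \<omega>|M. action_cost (T \<omega>) (a (cell_index K C (T \<omega>))))
      = (LINT \<omega>|M. (\<Sum>k\<in>{1..K}. ?f k \<omega>))"
    by (rule Bochner_Integration.integral_cong[OF refl eq])
  also have "\<dots> = (\<Sum>k\<in>{1..K}. LINT \<omega>|M. ?f k \<omega>)"
    by (rule Bochner_Integration.integral_sum[OF f(1)])
  also have "\<dots> = (\<Sum>k\<in>{1..K}. 2 * (cell_moment M T (C k) \<bullet> a k)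
        + measure M (cell_event M T (C k)) * (norm (a k))\<^sup>2)"
    by (rule sum.cong[OF refl f(2)])
  finally show "(LINT \<omega>|M. action_cost (T \<omega>) (a (cell_index K C (T \<omega>)))) =
      (\<Sum>k\<in>{1..K}. 2 * (cell_moment M T (C k) \<bullet> a k)
        + measure M (cell_event M T (C k)) * (norm (a k))\<^sup>2)" .
qed

lemma task_loss_integrable:
  assumes "random_load_vector M T" "0 \<le> E" "measurable_partition K C"
  shows "integrable M (\<lambda>\<omega>. task_loss E (T \<omega>) (a (cell_index K C (T \<omega>))))"
  unfolding task_loss_eq
  by (intro Bochner_Integration.integrable_diff action_cost_cell_index_integral
      optimal_action_cost_integrable assms)

text \<open>The subtracted integral depends on neither cells nor actions, so comparing actions and
  passing to limits only concern the finite sum.\<close>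

lemma distortion_eq:
  assumes "random_load_vector M T" "0 \<le> E" "measurable_partition K C"
  shows "distortion M T E K C a =
    (\<Sum>k\<in>{1..K}. 2 * (cell_moment M T (C k) \<bullet> a k)
      + measure M (cell_event M T (C k)) * (norm (a k))\<^sup>2)
    - (LINT \<omega>|M. action_cost (T \<omega>) (opt_action E (T \<omega>)))"
  unfolding distortion_def task_loss_eq
  by (simp add: Bochner_Integration.integral_diff action_cost_cell_index_integral
      optimal_action_cost_integrable assms)

text \<open>Runs prescribe actions only at indices in \<open>{1..K}\<close>, so agreement of two
  action families is available only there.\<close>

lemma distortion_cong:
  assumes "random_load_vector M T" "0 \<le> E" "measurable_partition K C"
    and "\<And>k. k \<in> {1..K} \<Longrightarrow> a k = b k"
  shows "distortion M T E K C a = distortion M T E K C b"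
  using assms(4) by (simp add: distortion_eq[OF assms(1-3)])

text \<open>Holds pointwise, since \<open>opt_action\<close> is optimal for each load. This is the
  lower bound behind convergence along a run.\<close>

lemma distortion_nonneg:
  assumes load: "random_load_vector M T" and "0 \<le> E" and C: "measurable_partition K C"
    and a: "feasible_actions E K a"
  shows "0 \<le> distortion M T E K C a"
  unfolding distortion_def task_loss_eq
proof (rule Bochner_Integration.integral_nonneg)
  fix \<omega>
  assume "\<omega> \<in> space M"
  then have "T \<omega> \<in> load_space"
    using load by (simp add: random_load_vector_def)
  from cell_index_mem(1)[OF C this]
  have "a (cell_index K C (T \<omega>)) \<in> action_simplex E"
    using a unfolding feasible_actions_def by blast
  from action_cost_opt_action_le[OF assms(2) this]
  show "0 \<le> action_cost (T \<omega>) (a (cell_index K C (T \<omega>))) - action_cost (T \<omega>) (opt_action E (T \<omega>))"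
    by simp
qed

section \<open>The two updates\<close>

lemma action_update_feasible:
  assumes "0 \<le> E"
  shows "feasible_actions E K (action_update M T E C)"
  by (simp add: feasible_actions_def action_update_def water_fill_in_action_simplex[OF assms])

text \<open>Up to a constant, the distortion is the sum of cell probabilities times action costs at
  the conditional means, so the quadratic gap of water-filling is inherited cell by cell.\<close>

lemma distortion_action_update_strongly_minimal:
  assumes load: "random_load_vector M T" and E: "0 \<le> E" and C: "quantizer_cells M T K C"
    and b: "feasible_actions E K b"
  shows "distortion M T E K C (action_update M T E C)
    + (\<Sum>k\<in>{1..K}. measure M (cell_event M T (C k)) * (norm (b k - action_update M T E C k))\<^sup>2)
    \<le> distortion M T E K C b"
proof -
  let ?p = "\<lambda>k. measure M (cell_event M T (C k))"
  let ?u = "action_update M T E C"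
  have part: "measurable_partition K C" and pos: "\<And>k. k \<in> {1..K} \<Longrightarrow> 0 < ?p k"
    using C by (auto simp: quantizer_cells_def)
  \<comment> \<open>Positive cell probability permits the division that turns the moment into the
    conditional mean.\<close>
  have eq: "2 * (cell_moment M T (C k) \<bullet> a) + ?p k * (norm a)\<^sup>2
      = ?p k * action_cost (cell_mean M T (C k)) a" if "k \<in> {1..K}" for k a
    using pos[OF that]
    by (simp add: cell_mean_def cell_moment_def action_cost_def field_simps)
  have le: "(\<Sum>k\<in>{1..K}. ?p k * action_cost (cell_mean M T (C k)) (?u k))
      + (\<Sum>k\<in>{1..K}. ?p k * (norm (b k - ?u k))\<^sup>2)
    \<le> (\<Sum>k\<in>{1..K}. ?p k * action_cost (cell_mean M T (C k)) (b k))"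
    unfolding sum.distrib[symmetric]
  proof (rule sum_mono)
    fix k
    assume "k \<in> {1..K}"
    then have "action_cost (cell_mean M T (C k)) (?u k) + (norm (b k - ?u k))\<^sup>2
        \<le> action_cost (cell_mean M T (C k)) (b k)"
      using b unfolding action_update_def feasible_actions_def
      by (intro action_cost_water_fill_strongly_minimal[OF E]) blast
    from mult_left_mono[OF this measure_nonneg[of M "cell_event M T (C k)"]]
    show "?p k * action_cost (cell_mean M T (C k)) (?u k) + ?p k * (norm (b k - ?u k))\<^sup>2
        \<le> ?p k * action_cost (cell_mean M T (C k)) (b k)"
      by (simp add: distrib_left)
  qed
  have D: "distortion M T E K C a = (\<Sum>k\<in>{1..K}. ?p k * action_cost (cell_mean M T (C k)) (a k))
      - (LINT \<omega>|M. action_cost (T \<omega>) (opt_action E (T \<omega>)))" for a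
    unfolding distortion_eq[OF load E part] by (intro arg_cong2[where f = minus] sum.cong refl eq)
  show ?thesis
    unfolding D diff_add_eq by (rule diff_right_mono) (rule le)
qed

lemma distortion_action_update_le:
  assumes "random_load_vector M T" "0 \<le> E" "quantizer_cells M T K C" "feasible_actions E K b"
  shows "distortion M T E K C (action_update M T E C) \<le> distortion M T E K C b"
proof -
  have "0 \<le> (\<Sum>k\<in>{1..K}. measure M (cell_event M T (C k))
      * (norm (b k - action_update M T E C k))\<^sup>2)"
    by (intro sum_nonneg) auto
  with distortion_action_update_strongly_minimal[OF assms] show ?thesis
    by linarith
qed

text \<open>The gap terms are nonnegative with sum at most zero, so each vanishes; positive cell
  probability then forces the actions to coincide.\<close>

lemma minimizing_actions_unique:
  assumes "random_load_vector M T" "0 \<le> E" and C: "quantizer_cells M T K C"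
    and "feasible_actions E K b"
    and le: "distortion M T E K C b \<le> distortion M T E K C (action_update M T E C)"
    and k: "k \<in> {1..K}"
  shows "b k = action_update M T E C k"
proof -
  let ?f = "\<lambda>k. measure M (cell_event M T (C k)) * (norm (b k - action_update M T E C k))\<^sup>2"
  have "?f k \<le> (\<Sum>k\<in>{1..K}. ?f k)"
    using k by (intro member_le_sum) auto
  also have "\<dots> \<le> 0"
    using distortion_action_update_strongly_minimal[OF assms(1-4)] le by linarith
  finally have "?f k \<le> 0" .
  moreover have "0 < measure M (cell_event M T (C k))"
    using C k unfolding quantizer_cells_def by blast
  ultimately show ?thesis
    by (simp add: mult_le_0_iff)
qed

section \<open>The encoder update\<close>

lemma load_space_borel: "load_space \<in> sets borel"
proof (rule borel_closed)
  show "closed load_space"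
    unfolding load_space_def by (intro closed_Collect_all closed_Collect_le continuous_intros)
qed

text \<open>Ties go to the smallest index. The set where a given index is optimal is closed, being
  cut out by non-strict inequalities between continuous functions, so removing the earlier ones
  keeps the cells Borel.\<close>

lemma encoder_update_exists:
  fixes a :: "nat \<Rightarrow> real ^ 'n"
  assumes "1 \<le> K"
  shows "\<exists>C. encoder_update K a C"
proof -
  let ?g = "\<lambda>t j. 2 * (t \<bullet> a j) + (norm (a j))\<^sup>2"
  define B where "B k = (\<Inter>j\<in>{1..K}. {t. ?g t k \<le> ?g t j})" for k
  define C where "C k = load_space \<inter> B k - (\<Union>j\<in>{1..<k}. B j)" for k
  have B: "B k \<in> sets borel" for k
  proof -
    have "closed (B k)"
      unfolding B_def by (intro closed_INT ballI closed_Collect_le continuous_intros)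
    then show ?thesis
      by (rule borel_closed)
  qed
  have cover: "\<exists>k\<in>{1..K}. t \<in> C k" if t: "t \<in> load_space" for t
  proof -
    obtain k where k: "k \<in> {1..K}" "t \<in> B k"
      using assms ex_is_arg_min_if_finite[of "{1..K}" "?g t"]
      by (auto simp: B_def is_arg_min_linorder)
    \<comment> \<open>The smallest optimal index is the one whose cell contains
      \<open>t\<close>.\<close>
    define m where "m = (LEAST k. k \<in> {1..K} \<and> t \<in> B k)"
    have m: "m \<in> {1..K} \<and> t \<in> B m"
      unfolding m_def by (rule LeastI[of _ k]) (use k in blast)
    have "t \<notin> B j" if "j \<in> {1..<m}" for j
      using not_less_Least[of j "\<lambda>k. k \<in> {1..K} \<and> t \<in> B k"] that m by (auto simp: m_def)
    with m t have "t \<in> C m"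
      by (auto simp: C_def)
    with m show ?thesis
      by blast
  qed
  have "measurable_partition K C"
    unfolding measurable_partition_def
  proof (intro conjI ballI)
    show "C k \<in> sets borel" for k
      unfolding C_def by (intro sets.Diff sets.Int sets.finite_UN load_space_borel B) auto
    show "disjoint_family_on C {1..K}"
      unfolding disjoint_family_on_def
    proof (intro ballI impI)
      fix m n
      assume "m \<in> {1..K}" "n \<in> {1..K}" "m \<noteq> n"
      then show "C m \<inter> C n = {}"
        by (cases m n rule: linorder_cases) (auto simp: C_def)
    qed
    show "(\<Union>k\<in>{1..K}. C k) = load_space"
      using cover by (auto simp: C_def)
  qed
  moreover have "is_arg_min (?g t) (\<lambda>j. j \<in> {1..K}) k" if "k \<in> {1..K}" "t \<in> C k" for k t
    using that by (simp add: is_arg_min_linorder C_def B_def)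
  ultimately show ?thesis
    unfolding encoder_update_def by (intro exI[of _ C] conjI ballI) assumption+
qed

lemma distortion_encoder_update_le:
  assumes load: "random_load_vector M T" and E: "0 \<le> E"
    and C: "encoder_update K a C" and D: "measurable_partition K D"
  shows "distortion M T E K C a \<le> distortion M T E K D a"
  unfolding distortion_def
proof (rule Bochner_Integration.integral_mono)
  have part: "measurable_partition K C"
    using C by (simp add: encoder_update_def)
  show "integrable M (\<lambda>\<omega>. task_loss E (T \<omega>) (a (cell_index K C (T \<omega>))))"
    "integrable M (\<lambda>\<omega>. task_loss E (T \<omega>) (a (cell_index K D (T \<omega>))))"
    by (rule task_loss_integrable[OF load E part] task_loss_integrable[OF load E D])+
  fix \<omega>
  assume "\<omega> \<in> space M"
  then have t: "T \<omega> \<in> load_space"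
    using load by (simp add: random_load_vector_def)
  \<comment> \<open>The index chosen by \<open>D\<close> is a competitor in the minimization that
    \<open>C\<close> solves at this load.\<close>
  have "action_cost (T \<omega>) (a (cell_index K C (T \<omega>))) \<le> action_cost (T \<omega>) (a (cell_index K D (T \<omega>)))"
    using C cell_index_mem[OF part t] cell_index_mem[OF D t]
    unfolding encoder_update_def is_arg_min_linorder action_cost_def by blast
  then show "task_loss E (T \<omega>) (a (cell_index K C (T \<omega>))) \<le> task_loss E (T \<omega>) (a (cell_index K D (T \<omega>)))"
    by (simp add: task_loss_eq)
qed

text \<open>Certifies the stationary run of the counterexample.\<close>

lemma coordinatewise_optimum_if_fixed_point:
  assumes load: "random_load_vector M T" and E: "0 \<le> E" and Q: "quantizer M T E K C a"
    and a: "\<And>k. k \<in> {1..K} \<Longrightarrow> a k = action_update M T E C k" and C: "encoder_update K a C"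
  shows "coordinatewise_optimum M T E K C a"
proof -
  have qc: "quantizer_cells M T K C" and part: "measurable_partition K C"
    using Q by (auto simp: quantizer_def quantizer_cells_def)
  have "distortion M T E K C a \<le> distortion M T E K C b" if "feasible_actions E K b" for b
    using distortion_action_update_le[OF load E qc that] distortion_cong[OF load E part a] by simp
  then show ?thesis
    using Q distortion_encoder_update_le[OF load E C] by (simp add: coordinatewise_optimum_def)
qed

section \<open>Convergence of cells and actions\<close>

text \<open>Absolute continuity of the integral; \<open>f\<close> is truncated at a high level \<open>m\<close>.\<close>

lemma set_integral_tendsto_zero:
  fixes f :: "'b \<Rightarrow> real"
  assumes "finite_measure M" and f: "integrable M f" "\<And>x. 0 \<le> f x"
    and A: "\<And>n. A n \<in> sets M" and lim: "(\<lambda>n. measure M (A n)) \<longlonglongrightarrow> 0"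
  shows "(\<lambda>n. LINT x:A n|M. f x) \<longlonglongrightarrow> 0"
proof -
  interpret finite_measure M by fact
  \<comment> \<open>\<open>?t m\<close> keeps the part of \<open>f\<close> above level
    \<open>m\<close>; its integral vanishes as \<open>m\<close> grows, by dominated convergence with
    bound \<open>f\<close>.\<close>
  let ?t = "\<lambda>m x. if f x \<le> real m then 0 else f x"
  have [measurable]: "f \<in> borel_measurable M"
    using f(1) by simp
  have t: "integrable M (?t m)" for m
    by (rule Bochner_Integration.integrable_bound[OF f(1)]) auto
  have IA: "integrable M (indicator (A n) :: _ \<Rightarrow> real)" for n
    using A by (simp add: integrable_indicator_iff emeasure_eq_measure)
  have "(\<lambda>m. LINT x|M. ?t m x) \<longlonglongrightarrow> (LINT x|M. 0)"
  proof (rule integral_dominated_convergence[where w = f])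
    show "AE x in M. (\<lambda>m. ?t m x) \<longlonglongrightarrow> 0"
    proof (intro AE_I2 tendsto_eventually)
      fix x
      have "\<forall>\<^sub>F m in sequentially. f x \<le> real m"
        by (rule eventually_sequentiallyI[of "nat \<lceil>f x\<rceil>"]) linarith
      then show "\<forall>\<^sub>F m in sequentially. ?t m x = 0"
        by eventually_elim simp
    qed
  qed (use f in auto)
  then have tail: "(\<lambda>m. LINT x|M. ?t m x) \<longlonglongrightarrow> 0"
    by simp
  show ?thesis
  proof (rule tendstoI)
    fix e :: real
    assume e: "0 < e"
    have "\<forall>\<^sub>F m in sequentially. (LINT x|M. ?t m x) < e / 2"
      using e by (intro order_tendstoD(2)[OF tail]) simp
    then obtain m where m: "(LINT x|M. ?t m x) < e / 2"
      by (auto simp: eventually_sequentially)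
    have "(\<lambda>n. real m * measure M (A n)) \<longlonglongrightarrow> 0"
      using tendsto_mult_right_zero[OF lim] by simp
    then have "\<forall>\<^sub>F n in sequentially. real m * measure M (A n) < e / 2"
      using e by (intro order_tendstoD(2)) auto
    then show "\<forall>\<^sub>F n in sequentially. dist (LINT x:A n|M. f x) 0 < e"
    proof eventually_elim
      case (elim n)
      \<comment> \<open>On \<open>A n\<close> the integrand is at most \<open>m\<close> plus the
        tail, and the tail is integrated over the whole space. Hence \<open>m\<close> can be fixed
        before \<open>n\<close>.\<close>
      have "(LINT x:A n|M. f x) \<le> (LINT x|M. real m * indicator (A n) x + ?t m x)"
        unfolding set_lebesgue_integral_def
      proof (rule Bochner_Integration.integral_mono)
        show "integrable M (\<lambda>x. indicator (A n) x *\<^sub>R f x)"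
          by (rule integrable_mult_indicator[OF A f(1)])
        show "integrable M (\<lambda>x. real m * indicator (A n) x + ?t m x)"
          by (intro Bochner_Integration.integrable_add integrable_mult_right IA t)
      qed (use f(2) in \<open>auto simp: indicator_def\<close>)
      also have "\<dots> = real m * measure M (A n) + (LINT x|M. ?t m x)"
        using A by (subst Bochner_Integration.integral_add)
          (auto intro!: integrable_mult_right IA t simp: sets.Int_space_eq2)
      also have "\<dots> < e"
        using elim m by linarith
      finally have "(LINT x:A n|M. f x) < e" .
      moreover have "0 \<le> (LINT x:A n|M. f x)"
        unfolding set_lebesgue_integral_def
        by (intro Bochner_Integration.integral_nonneg) (simp add: f(2))
      ultimately show ?case
        by simp
    qed
  qed
qed

text \<open>Two events differ in probability by at most the probability of their symmetric
  difference.\<close>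

lemma cell_measure_tendsto:
  assumes load: "random_load_vector M T" and C: "\<And>n. C n \<in> sets borel" and C': "C' \<in> sets borel"
    and lim: "(\<lambda>n. measure M (cell_event M T ((C n - C') \<union> (C' - C n)))) \<longlonglongrightarrow> 0"
  shows "(\<lambda>n. measure M (cell_event M T (C n))) \<longlonglongrightarrow> measure M (cell_event M T C')"
proof -
  interpret prob_space M
    using load by (simp add: random_load_vector_def)
  have T: "T \<in> borel_measurable M"
    using load by (simp add: random_load_vector_def)
  note ev = cell_event_sets[OF T]
  have sub: "prob (cell_event M T A)
      \<le> prob (cell_event M T B) + prob (cell_event M T ((A - B) \<union> (B - A)))"
    if "A \<in> sets borel" "B \<in> sets borel" for A B
  proof -
    have "prob (cell_event M T A)
        \<le> prob (cell_event M T B \<union> cell_event M T ((A - B) \<union> (B - A)))"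
      using that by (intro finite_measure_mono sets.Un ev) (auto simp: cell_event_def)
    also have "\<dots> \<le> prob (cell_event M T B) + prob (cell_event M T ((A - B) \<union> (B - A)))"
      using that by (intro measure_Un_le ev) auto
    finally show ?thesis .
  qed
  have "norm (prob (cell_event M T (C n)) - prob (cell_event M T C'))
      \<le> prob (cell_event M T ((C n - C') \<union> (C' - C n)))" for n
    using sub[OF C C', of n] sub[OF C' C, of n] by (simp add: Un_commute)
  then have "(\<lambda>n. prob (cell_event M T (C n)) - prob (cell_event M T C')) \<longlonglongrightarrow> 0"
    by (rule Lim_null_comparison[OF always_eventually[OF allI] lim])
  then show ?thesis
    by (rule LIM_zero_cancel)
qed

text \<open>The indicators differ exactly on the symmetric difference, so the moments differ by at
  most the integral of \<open>norm (T \<omega>)\<close> over it, which vanishes by absolute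
  continuity.\<close>

lemma cell_moment_tendsto:
  assumes load: "random_load_vector M T" and C: "\<And>n. C n \<in> sets borel" and C': "C' \<in> sets borel"
    and lim: "(\<lambda>n. measure M (cell_event M T ((C n - C') \<union> (C' - C n)))) \<longlonglongrightarrow> 0"
  shows "(\<lambda>n. cell_moment M T (C n)) \<longlonglongrightarrow> cell_moment M T C'"
proof -
  interpret prob_space M
    using load by (simp add: random_load_vector_def)
  have T: "T \<in> borel_measurable M" "integrable M T"
    using load by (simp_all add: random_load_vector_def)
  note ev = cell_event_sets[OF T(1)]
  let ?D = "\<lambda>n. cell_event M T ((C n - C') \<union> (C' - C n))"
  have D: "?D n \<in> sets M" for n
    using C C' by (intro ev) auto
  have "norm (cell_moment M T (C n) - cell_moment M T C') \<le> (LINT \<omega>:?D n|M. norm (T \<omega>))" for n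
  proof -
    let ?d = "\<lambda>\<omega>. indicat_real (cell_event M T (C n)) \<omega> *\<^sub>R T \<omega>
      - indicat_real (cell_event M T C') \<omega> *\<^sub>R T \<omega>"
    have int: "integrable M (\<lambda>\<omega>. indicat_real (cell_event M T (C n)) \<omega> *\<^sub>R T \<omega>)"
      "integrable M (\<lambda>\<omega>. indicat_real (cell_event M T C') \<omega> *\<^sub>R T \<omega>)"
      by (intro integrable_mult_indicator ev C C' T)+
    have "cell_moment M T (C n) - cell_moment M T C' = (LINT \<omega>|M. ?d \<omega>)"
      unfolding cell_moment_def set_lebesgue_integral_def
      by (rule Bochner_Integration.integral_diff[OF int, symmetric])
    also have "norm \<dots> \<le> (LINT \<omega>|M. norm (?d \<omega>))"
      by (rule integral_norm_bound)
    also have "\<dots> = (LINT \<omega>:?D n|M. norm (T \<omega>))"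
      unfolding set_lebesgue_integral_def
      by (intro Bochner_Integration.integral_cong) (auto simp: indicator_def cell_event_def)
    finally show ?thesis .
  qed
  moreover have "(\<lambda>n. LINT \<omega>:?D n|M. norm (T \<omega>)) \<longlonglongrightarrow> 0"
    using T(2) by (intro set_integral_tendsto_zero D lim finite_measure_axioms) auto
  ultimately have "(\<lambda>n. cell_moment M T (C n) - cell_moment M T C') \<longlonglongrightarrow> 0"
    by (rule Lim_null_comparison[OF always_eventually[OF allI]])
  then show ?thesis
    by (rule LIM_zero_cancel)
qed

text \<open>The finite sum in \<open>distortion_eq\<close> is continuous in probabilities, moments
  and actions. Convergence of cells is measured by the probability of symmetric differences.\<close>

lemma distortion_tendsto:
  assumes load: "random_load_vector M T" and E: "0 \<le> E"
    and C: "\<And>n. measurable_partition K (C n)" and C': "measurable_partition K C'"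
    and a: "\<And>k. k \<in> {1..K} \<Longrightarrow> (\<lambda>n. a n k) \<longlonglongrightarrow> a' k"
    and lim: "\<And>k. k \<in> {1..K} \<Longrightarrow>
      (\<lambda>n. measure M (cell_event M T ((C n k - C' k) \<union> (C' k - C n k)))) \<longlonglongrightarrow> 0"
  shows "(\<lambda>n. distortion M T E K (C n) (a n)) \<longlonglongrightarrow> distortion M T E K C' a'"
proof -
  have "C n k \<in> sets borel" "C' k \<in> sets borel" if "k \<in> {1..K}" for n k
    using C[of n] C' that by (auto simp: measurable_partition_def)
  then show ?thesis
    unfolding distortion_eq[OF load E C] distortion_eq[OF load E C']
    by (intro tendsto_intros a cell_moment_tendsto[OF load] cell_measure_tendsto[OF load] lim)
qed

lemma closed_action_simplex: "closed (action_simplex E)"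
proof -
  have "closed ({a. \<forall>i. 0 \<le> a $ i} \<inter> {a :: real ^ 'n. (\<Sum>i\<in>UNIV. a $ i) = E})"
    by (intro closed_Int closed_Collect_all closed_Collect_le closed_Collect_eq continuous_intros)
  then show ?thesis
    by (simp add: action_simplex_def Collect_conj_eq)
qed

section \<open>The alternation\<close>

context
  fixes M :: "'b measure" and T :: "'b \<Rightarrow> real ^ 'n" and E :: real and K :: nat
    and C :: "nat \<Rightarrow> nat \<Rightarrow> (real ^ 'n) set" and a :: "nat \<Rightarrow> nat \<Rightarrow> real ^ 'n"
  assumes load: "random_load_vector M T" and E: "0 \<le> E" and run: "alternating_run M T E K C a"
begin

lemma run_quantizer:
  "quantizer M T E K (C n) (a n)" "quantizer_cells M T K (C n)"
  "measurable_partition K (C n)" "feasible_actions E K (a n)"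
  using run by (auto simp: alternating_run_def quantizer_def quantizer_cells_def)

lemma run_action_update: "k \<in> {1..K} \<Longrightarrow> a (Suc n) k = action_update M T E (C n) k"
  using run by (simp add: alternating_run_def)

lemma run_action_step:
  "distortion M T E K (C n) (a (Suc n)) = distortion M T E K (C n) (action_update M T E (C n))"
  by (rule distortion_cong[OF load E run_quantizer(3) run_action_update])

lemma run_action_step_le:
  "feasible_actions E K b \<Longrightarrow>
    distortion M T E K (C n) (a (Suc n)) \<le> distortion M T E K (C n) b"
  unfolding run_action_step by (rule distortion_action_update_le[OF load E run_quantizer(2)])

text \<open>Stated at \<open>Suc n\<close> because the initial cells \<open>C 0\<close> need not
  come from an encoder update.\<close>

lemma run_encoder_step_le:
  "measurable_partition K D \<Longrightarrow>
    distortion M T E K (C (Suc n)) (a (Suc n)) \<le> distortion M T E K D (a (Suc n))"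
  using run by (intro distortion_encoder_update_le[OF load E]) (simp_all add: alternating_run_def)

lemma run_decreasing:
  "distortion M T E K (C (Suc n)) (a (Suc n)) \<le> distortion M T E K (C n) (a n)"
  using run_encoder_step_le[OF run_quantizer(3)] run_action_step_le[OF run_quantizer(4)]
  by (rule order_trans)

text \<open>Equality in a round forces \<open>a n\<close> to agree with the updated actions, because the minimizing
  actions are unique; this is what makes the claim hold also for \<open>n = 0\<close>, where the cells do not
  come from an encoder update.\<close>

lemma run_stationary_iff:
  "distortion M T E K (C (Suc n)) (a (Suc n)) = distortion M T E K (C n) (a n) \<longleftrightarrow>
    coordinatewise_optimum M T E K (C n) (a n)" (is "?eq \<longleftrightarrow> ?opt")
proof -
  \<comment> \<open>If the action step gains nothing, uniqueness identifies old and new actions, so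
    they have equal distortion on every partition.\<close>
  have same: "distortion M T E K D (a n) = distortion M T E K D (a (Suc n))"
    if "distortion M T E K (C n) (a n) \<le> distortion M T E K (C n) (a (Suc n))"
      and D: "measurable_partition K D" for D
  proof (rule distortion_cong[OF load E D])
    fix k
    assume k: "k \<in> {1..K}"
    have "a n k = action_update M T E (C n) k"
      using that(1) unfolding run_action_step
      by (rule minimizing_actions_unique[OF load E run_quantizer(2,4) _ k])
    then show "a n k = a (Suc n) k"
      by (simp add: run_action_update[OF k])
  qed
  show ?thesis
  proof
    assume eq: ?eq
    then have le: "distortion M T E K (C n) (a n) \<le> distortion M T E K (C n) (a (Suc n))"
      using run_encoder_step_le[OF run_quantizer(3), of n n] by simp
    show ?opt
      unfolding coordinatewise_optimum_def
    proof (intro conjI allI impI)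
      show "quantizer M T E K (C n) (a n)"
        by (rule run_quantizer(1))
      show "distortion M T E K (C n) (a n) \<le> distortion M T E K (C n) b"
        if "feasible_actions E K b" for b
        using le run_action_step_le[OF that] by (rule order_trans)
      show "distortion M T E K (C n) (a n) \<le> distortion M T E K D (a n)"
        \<comment> \<open>The new cells are optimal for the new actions, which \<open>same\<close>
          lets stand in for the old ones.\<close>
        if "measurable_partition K D" for D
        using eq run_encoder_step_le[OF that, of n] same[OF le that] by simp
    qed
  next
    assume ?opt
    then have "distortion M T E K (C n) (a n) \<le> distortion M T E K (C n) (a (Suc n))"
      and "distortion M T E K (C n) (a n) \<le> distortion M T E K (C (Suc n)) (a n)"
      using run_quantizer(3,4) by (simp_all add: coordinatewise_optimum_def)
    \<comment> \<open>Sandwich: optimality of the old cells bounds the old distortion by that of the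
      new cells with the old actions, hence with the new ones; descent gives the converse.\<close>
    with same[OF this(1) run_quantizer(3)] run_decreasing[of n] show ?eq
      by (metis order_antisym)
  qed
qed

lemma run_convergent: "convergent (\<lambda>n. distortion M T E K (C n) (a n))"
proof (rule Bseq_monoseq_convergent)
  have dec: "decseq (\<lambda>n. distortion M T E K (C n) (a n))"
    by (rule decseq_SucI) (rule run_decreasing)
  then show "monoseq (\<lambda>n. distortion M T E K (C n) (a n))"
    by (rule decseq_imp_monoseq)
  show "Bseq (\<lambda>n. distortion M T E K (C n) (a n))"
    using decseqD[OF dec, of 0] distortion_nonneg[OF load E run_quantizer(3,4)]
    by (intro BseqI'[of _ "distortion M T E K (C 0) (a 0)"]) simp
qed

text \<open>The excess over the best actions for \<open>C n\<close> is the gain of the next action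
  step, bounded by the decrease in that round. Decreases tend to zero because the distortions
  converge.\<close>

lemma run_eventually_optimal:
  assumes "0 < \<epsilon>"
  shows "\<forall>\<^sub>F n in sequentially.
    (\<forall>b. feasible_actions E K b \<longrightarrow>
       distortion M T E K (C n) (a n) \<le> distortion M T E K (C n) b + \<epsilon>) \<and>
    (\<forall>D. measurable_partition K D \<longrightarrow>
       distortion M T E K (C n) (a n) \<le> distortion M T E K D (a n))"
proof -
  let ?d = "\<lambda>n. distortion M T E K (C n) (a n)"
  obtain L where L: "?d \<longlonglongrightarrow> L"
    using run_convergent by (auto simp: convergent_def)
  have "(\<lambda>n. ?d n - ?d (Suc n)) \<longlonglongrightarrow> L - L"
    by (intro tendsto_diff L LIMSEQ_Suc[OF L])
  then have "\<forall>\<^sub>F n in sequentially. ?d n - ?d (Suc n) < \<epsilon>"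
    using assms by (intro order_tendstoD(2)) auto
  \<comment> \<open>From index 1 on the cells come from an encoder update, hence are exactly
    optimal.\<close>
  moreover have "\<forall>\<^sub>F n in sequentially. 0 < n"
    by (rule eventually_gt_at_top)
  ultimately show ?thesis
  proof eventually_elim
    case (elim n)
    then obtain m where m: "n = Suc m"
      using gr0_implies_Suc by blast
    have "?d n \<le> distortion M T E K (C n) b + \<epsilon>" if "feasible_actions E K b" for b
      using elim(1) run_encoder_step_le[OF run_quantizer(3), of n n] run_action_step_le[OF that, of n]
      by linarith
    then show ?case
      using run_encoder_step_le m by blast
  qed
qed

text \<open>Both inequalities of \<open>run_eventually_optimal\<close> pass to the limit along the
  subsequence. The distortions converge as a whole, so the subsequence determines their
  limit.\<close>

lemma run_limit_point:
  assumes r: "strict_mono r" and C': "quantizer_cells M T K C'"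
    and a': "\<And>k. k \<in> {1..K} \<Longrightarrow> (\<lambda>n. a (r n) k) \<longlonglongrightarrow> a' k"
    and lim: "\<And>k. k \<in> {1..K} \<Longrightarrow>
      (\<lambda>n. measure M (cell_event M T ((C (r n) k - C' k) \<union> (C' k - C (r n) k)))) \<longlonglongrightarrow> 0"
  shows "coordinatewise_optimum M T E K C' a'"
    and "(\<lambda>n. distortion M T E K (C n) (a n)) \<longlonglongrightarrow> distortion M T E K C' a'"
proof -
  let ?d = "\<lambda>n. distortion M T E K (C n) (a n)"
  have part: "measurable_partition K C'"
    using C' by (simp add: quantizer_cells_def)
  have d: "(\<lambda>n. ?d (r n)) \<longlonglongrightarrow> distortion M T E K C' a'"
    by (rule distortion_tendsto[OF load E run_quantizer(3) part a' lim])
  have dev: "\<forall>\<^sub>F n in sequentially. P (r n)" if "eventually P sequentially" for P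
    using that filterlim_subseq[OF r] by (rule eventually_compose_filterlim)
  obtain L where L: "?d \<longlonglongrightarrow> L"
    using run_convergent by (auto simp: convergent_def)
  then have "(\<lambda>n. ?d (r n)) \<longlonglongrightarrow> L"
    using LIMSEQ_subseq_LIMSEQ[OF L r] by (simp add: comp_def)
  with d have "L = distortion M T E K C' a'"
    by (metis LIMSEQ_unique)
  with L show "?d \<longlonglongrightarrow> distortion M T E K C' a'"
    by simp
  \<comment> \<open>Feasibility survives the limit because the simplex is closed.\<close>
  have "a' k \<in> action_simplex E" if k: "k \<in> {1..K}" for k
    using closed_action_simplex _ a'[OF k]
  proof (rule closed_sequentially)
    show "a (r n) k \<in> action_simplex E" for n
      using run_quantizer(4)[of "r n"] k unfolding feasible_actions_def by blast
  qed
  then have feas: "feasible_actions E K a'"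
    by (simp add: feasible_actions_def)
  show "coordinatewise_optimum M T E K C' a'"
    unfolding coordinatewise_optimum_def quantizer_def
  proof (intro conjI allI impI C' feas)
    fix b :: "nat \<Rightarrow> real ^ 'n"
    assume b: "feasible_actions E K b"
    have db: "(\<lambda>n. distortion M T E K (C (r n)) b) \<longlonglongrightarrow> distortion M T E K C' b"
      by (rule distortion_tendsto[OF load E run_quantizer(3) part tendsto_const lim])
    show "distortion M T E K C' a' \<le> distortion M T E K C' b"
    proof (rule field_le_epsilon)
      fix \<epsilon> :: real
      assume "0 < \<epsilon>"
      from dev[OF run_eventually_optimal[OF this]]
      have "\<forall>\<^sub>F n in sequentially. ?d (r n) \<le> distortion M T E K (C (r n)) b + \<epsilon>"
        by eventually_elim (use b in blast)
      from tendsto_le[OF sequentially_bot tendsto_add[OF db tendsto_const] d this]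
      show "distortion M T E K C' a' \<le> distortion M T E K C' b + \<epsilon>" .
    qed
  next
    fix D :: "nat \<Rightarrow> (real ^ 'n) set"
    assume D: "measurable_partition K D"
    \<comment> \<open>With \<open>D\<close> fixed the symmetric differences are empty, so only the
      actions vary.\<close>
    have dD: "(\<lambda>n. distortion M T E K D (a (r n))) \<longlonglongrightarrow> distortion M T E K D a'"
      by (rule distortion_tendsto[OF load E D D a']) (simp_all add: cell_event_def)
    from dev[OF run_eventually_optimal[OF zero_less_one]]
    have "\<forall>\<^sub>F n in sequentially. ?d (r n) \<le> distortion M T E K D (a (r n))"
      by eventually_elim (use D in blast)
    from tendsto_le[OF sequentially_bot dD d this]
    show "distortion M T E K C' a' \<le> distortion M T E K D a'" .
  qed
qed

end

section \<open>A stationary run that is not globally optimal\<close>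

lemma measurable_partition_point:
  assumes "x \<in> load_space"
  shows "measurable_partition 2 (\<lambda>k. if k = 1 then {x} else load_space - {x})"
proof -
  have "{1..2 :: nat} = {1, 2}"
    by auto
  then show ?thesis
    using assms load_space_borel
    by (auto simp: measurable_partition_def disjoint_family_on_def)
qed

text \<open>The load is uniform on \<open>(1,1)\<close>, \<open>(2,0)\<close>, \<open>(0,2)\<close>. The cells \<open>{(1,1)}\<close> and its complement
  have the same conditional mean, hence the same action, so that every assignment is an encoder
  update; splitting off \<open>(2,0)\<close> instead is strictly better.\<close>

lemma stationary_run_not_globally_optimal:
  "\<exists>(M :: (real ^ 2) measure) (T :: real ^ 2 \<Rightarrow> real ^ 2) E K C a D b.
    random_load_vector M T \<and> 0 \<le> E \<and> 1 \<le> K \<and>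
    alternating_run M T E K C a \<and> quantizer M T E K D b \<and>
    (\<forall>n. coordinatewise_optimum M T E K (C n) (a n) \<and>
         distortion M T E K D b < distortion M T E K (C n) (a n))"
proof -
  define p q r :: "real ^ 2" where "p = vector [1, 1]" and "q = vector [2, 0]" and "r = vector [0, 2]"
  note pqr = p_def q_def r_def
  define S where "S = {p, q, r}"
  have ne: "p \<noteq> q" "p \<noteq> r" "q \<noteq> r"
    by (auto simp: pqr vec_eq_iff forall_2)
  have S: "finite S" "S \<noteq> {}" "card S = 3"
    using ne by (auto simp: S_def)
  have pos: "p \<in> load_space" "q \<in> load_space" "r \<in> load_space"
    by (auto simp: pqr load_space_def forall_2)
  define M where "M = measure_pmf (pmf_of_set S)"
  have space: "space M = UNIV"
    by (simp add: M_def)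
  \<comment> \<open>The value \<open>p\<close> off the support keeps \<open>T\<close> in the load
    space at every point, as \<open>random_load_vector\<close> demands.\<close>
  define T where "T x = (if x \<in> S then x else p)" for x
  have T: "T p = p" "T q = q" "T r = r"
    by (simp_all add: T_def S_def)
  have integral: "(LINT x|M. f x) = (1 / 3) *\<^sub>R (f p + f q + f r)"
    for f :: "real ^ 2 \<Rightarrow> 'c :: {banach, second_countable_topology}"
  proof -
    have "(LINT x|M. f x) = (\<Sum>x\<in>S. pmf (pmf_of_set S) x *\<^sub>R f x)"
      unfolding M_def by (rule integral_measure_pmf) (use S in auto)
    also have "\<dots> = (\<Sum>x\<in>S. (1 / 3) *\<^sub>R f x)"
      using S by (intro sum.cong) auto
    also have "\<dots> = (1 / 3) *\<^sub>R (f p + f q + f r)"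
      using ne by (simp add: S_def scaleR_add_right)
    finally show ?thesis .
  qed
  have prob: "measure M (cell_event M T A) = (1 / 3) * (indicator A p + indicator A q + indicator A r)"
    for A
  proof -
    have "measure M (cell_event M T A) = (LINT x|M. indicator (cell_event M T A) x)"
      by (simp add: M_def)
    also have "\<dots> = (1 / 3) * (indicator A p + indicator A q + indicator A r)"
      by (simp add: integral indicator_def cell_event_def T space)
    finally show ?thesis .
  qed
  have moment: "(LINT x:cell_event M T A|M. T x) =
      (1 / 3) *\<^sub>R (indicator A p *\<^sub>R p + indicator A q *\<^sub>R q + indicator A r *\<^sub>R r)" for A
    unfolding set_lebesgue_integral_def
    by (simp add: integral indicator_def cell_event_def T space)
  have load: "random_load_vector M T"
    unfolding random_load_vector_def
  proof (intro conjI ballI)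
    show "prob_space M"
      unfolding M_def by (rule measure_pmf.prob_space_axioms)
    show "T \<in> borel_measurable M"
      by (simp add: M_def)
    show "T x \<in> load_space" for x
      using pos by (simp add: T_def S_def)
    show "integrable M T"
      unfolding M_def by (rule integrable_measure_pmf_finite) (use S in simp)
  qed
  define C where "C k = (if k = 1 then {p} else load_space - {p})" for k :: nat
  define D where "D k = (if k = 1 then {q} else load_space - {q})" for k :: nat
  \<comment> \<open>\<open>r\<close> is the water-filling of \<open>q\<close>, levelling it to
    (2,2). The action \<open>p\<close> on the other cell is not optimal there, but suffices for a
    strict gain.\<close>
  define b where "b k = (if k = 1 then r else p)" for k :: nat
  have part: "measurable_partition 2 C" "measurable_partition 2 D"
    using measurable_partition_point pos unfolding C_def D_def by blast+
  have two: "{1..2 :: nat} = {1, 2}"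
    by auto
  have cells: "quantizer_cells M T 2 C" "quantizer_cells M T 2 D"
    using part ne pos by (auto simp: quantizer_cells_def two C_def D_def prob indicator_def)
  have wf: "water_fill 2 p = p"
  proof -
    \<comment> \<open>The coordinates of \<open>p\<close> agree, so each receives half of the budget
      2.\<close>
    have "max 0 (water_level 2 p - 1) = 1"
      using water_level_sum[of 2 p] by (simp add: sum_2 p_def)
    then show ?thesis
      by (simp add: water_fill_def p_def vec_eq_iff forall_2)
  qed
  have update: "action_update M T 2 C k = p" if "k \<in> {1..2}" for k
  proof -
    have qr: "q + r = 2 *\<^sub>R p"
      by (simp add: pqr vec_eq_iff forall_2)
    have "cell_mean M T (C k) = p"
      using that ne pos qr
      by (auto simp: two cell_mean_def moment prob C_def indicator_def)
    then show ?thesis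
      by (simp add: action_update_def wf)
  qed
  have simplex: "p \<in> action_simplex 2" "r \<in> action_simplex 2"
    by (auto simp: pqr action_simplex_def forall_2 sum_2)
  have Q: "quantizer M T 2 2 C (\<lambda>_. p)" "quantizer M T 2 2 D b"
    using cells simplex by (auto simp: quantizer_def feasible_actions_def b_def)
  have enc: "encoder_update 2 (\<lambda>_. p) C"
    using part by (simp add: encoder_update_def is_arg_min_linorder)
  have run: "alternating_run M T 2 2 (\<lambda>_. C) (\<lambda>_ _. p)"
    using Q enc update by (simp add: alternating_run_def)
  have opt: "coordinatewise_optimum M T 2 2 C (\<lambda>_. p)"
    using update by (intro coordinatewise_optimum_if_fixed_point[OF load _ Q(1) _ enc]) auto
  have "cell_index 2 D p = 2" "cell_index 2 D q = 1" "cell_index 2 D r = 2"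
    using ne pos by (auto intro!: cell_index_eq[OF part(2)] simp: D_def)
  \<comment> \<open>The action cost at \<open>q\<close> drops from 6 to 4, while it stays 6 at
    \<open>p\<close> and \<open>r\<close>.\<close>
  then have "distortion M T 2 2 D b < distortion M T 2 2 C (\<lambda>_. p)"
    by (simp add: distortion_def integral T b_def task_loss_eq)
      (simp add: action_cost_def pqr inner_vec_def sum_2 power2_norm_eq_inner)
  with load run Q(2) opt show ?thesis
    by (intro exI[of _ M] exI[of _ T] exI[of _ 2] exI[of _ "\<lambda>_. C"] exI[of _ "\<lambda>_ _. p"]
        exI[of _ D] exI[of _ b]) simp
qed

text \<open>Descent to an optimum does not assert finite termination: it is expressed through
  stationarity, eventual optimality up to any positive tolerance, and optimality of limit
  points.\<close>

theorem mainTheorem6: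
  fixes M :: "'b measure" and T :: "'b \<Rightarrow> real ^ 'n" and E :: real and K :: nat
  assumes load: "random_load_vector M T"
    and budget: "0 \<le> E"
    and levels: "1 \<le> K"
  shows
    \<comment> \<open>the expected task distortion is a genuine (finite) expectation\<close>
    "(\<forall>C a. measurable_partition K C \<and> feasible_actions E K a \<longrightarrow>
        integrable M (\<lambda>\<omega>. task_loss E (T \<omega>) (a (cell_index K C (T \<omega>)))))
   \<and> \<comment> \<open>the action update is feasible and minimizes the distortion for the given cells\<close>
     (\<forall>C. quantizer_cells M T K C \<longrightarrow>
        feasible_actions E K (action_update M T E C) \<and>
        (\<forall>b. feasible_actions E K b \<longrightarrow>
           distortion M T E K C (action_update M T E C) \<le> distortion M T E K C b))
   \<and> \<comment> \<open>encoder updates exist, and each one minimizes the distortion for the given actions\<close>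
     (\<forall>a. feasible_actions E K a \<longrightarrow>
        (\<exists>C. encoder_update K a C) \<and>
        (\<forall>C. encoder_update K a C \<longrightarrow>
           (\<forall>D. measurable_partition K D \<longrightarrow>
              distortion M T E K C a \<le> distortion M T E K D a)))
   \<and> \<comment> \<open>alternation: monotone descent to a coordinatewise optimum\<close>
     (\<forall>C a. alternating_run M T E K C a \<longrightarrow>
        (\<forall>n. distortion M T E K (C n) (a (Suc n)) \<le> distortion M T E K (C n) (a n) \<and>
             distortion M T E K (C (Suc n)) (a (Suc n)) \<le> distortion M T E K (C n) (a (Suc n))) \<and>
        (\<forall>n. distortion M T E K (C (Suc n)) (a (Suc n)) = distortion M T E K (C n) (a n) \<longleftrightarrow>
             coordinatewise_optimum M T E K (C n) (a n)) \<and>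
        convergent (\<lambda>n. distortion M T E K (C n) (a n)) \<and>
        (\<forall>\<epsilon>>0. \<forall>\<^sub>F n in sequentially.
           (\<forall>b. feasible_actions E K b \<longrightarrow>
              distortion M T E K (C n) (a n) \<le> distortion M T E K (C n) b + \<epsilon>) \<and>
           (\<forall>D. measurable_partition K D \<longrightarrow>
              distortion M T E K (C n) (a n) \<le> distortion M T E K D (a n))) \<and>
        (\<forall>r C' a'. strict_mono r \<and> quantizer_cells M T K C' \<and>
           (\<forall>k\<in>{1..K}. (\<lambda>n. a (r n) k) \<longlonglongrightarrow> a' k) \<and>
           (\<forall>k\<in>{1..K}. (\<lambda>n. measure M (cell_event M T ((C (r n) k - C' k) \<union> (C' k - C (r n) k))))
                          \<longlonglongrightarrow> 0) \<longrightarrow>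
           coordinatewise_optimum M T E K C' a' \<and>
           (\<lambda>n. distortion M T E K (C n) (a n)) \<longlonglongrightarrow> distortion M T E K C' a'))
   \<and> \<comment> \<open>no global optimality from arbitrary initialization\<close>
     (\<exists>(M' :: (real ^ 2) measure) (T' :: real ^ 2 \<Rightarrow> real ^ 2) E' K' C a D b.
        random_load_vector M' T' \<and> 0 \<le> E' \<and> 1 \<le> K' \<and>
        alternating_run M' T' E' K' C a \<and> quantizer M' T' E' K' D b \<and>
        (\<forall>n. coordinatewise_optimum M' T' E' K' (C n) (a n) \<and>
             distortion M' T' E' K' D b < distortion M' T' E' K' (C n) (a n)))"
proof (intro conjI)
  show "\<forall>C a. measurable_partition K C \<and> feasible_actions E K a \<longrightarrow>
      integrable M (\<lambda>\<omega>. task_loss E (T \<omega>) (a (cell_index K C (T \<omega>))))"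
    using task_loss_integrable[OF load budget] by blast
  show "\<forall>C. quantizer_cells M T K C \<longrightarrow> feasible_actions E K (action_update M T E C) \<and>
      (\<forall>b. feasible_actions E K b \<longrightarrow>
        distortion M T E K C (action_update M T E C) \<le> distortion M T E K C b)"
    using action_update_feasible[OF budget] distortion_action_update_le[OF load budget] by blast
  show "\<forall>a. feasible_actions E K a \<longrightarrow> (\<exists>C. encoder_update K a C) \<and>
      (\<forall>C. encoder_update K a C \<longrightarrow> (\<forall>D. measurable_partition K D \<longrightarrow>
        distortion M T E K C a \<le> distortion M T E K D a))"
    using encoder_update_exists[OF levels] distortion_encoder_update_le[OF load budget] by blast
  show "(\<forall>C a. alternating_run M T E K C a \<longrightarrow>
        (\<forall>n. distortion M T E K (C n) (a (Suc n)) \<le> distortion M T E K (C n) (a n) \<and>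
             distortion M T E K (C (Suc n)) (a (Suc n)) \<le> distortion M T E K (C n) (a (Suc n))) \<and>
        (\<forall>n. distortion M T E K (C (Suc n)) (a (Suc n)) = distortion M T E K (C n) (a n) \<longleftrightarrow>
             coordinatewise_optimum M T E K (C n) (a n)) \<and>
        convergent (\<lambda>n. distortion M T E K (C n) (a n)) \<and>
        (\<forall>\<epsilon>>0. \<forall>\<^sub>F n in sequentially.
           (\<forall>b. feasible_actions E K b \<longrightarrow>
              distortion M T E K (C n) (a n) \<le> distortion M T E K (C n) b + \<epsilon>) \<and>
           (\<forall>D. measurable_partition K D \<longrightarrow>
              distortion M T E K (C n) (a n) \<le> distortion M T E K D (a n))) \<and>
        (\<forall>r C' a'. strict_mono r \<and> quantizer_cells M T K C' \<and>
           (\<forall>k\<in>{1..K}. (\<lambda>n. a (r n) k) \<longlonglongrightarrow> a' k) \<and>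
           (\<forall>k\<in>{1..K}. (\<lambda>n. measure M (cell_event M T ((C (r n) k - C' k) \<union> (C' k - C (r n) k))))
                          \<longlonglongrightarrow> 0) \<longrightarrow>
           coordinatewise_optimum M T E K C' a' \<and>
           (\<lambda>n. distortion M T E K (C n) (a n)) \<longlonglongrightarrow> distortion M T E K C' a'))"
    (is "\<forall>C a. ?run C a \<longrightarrow> ?descent C a \<and> ?stationary C a \<and> ?convergent C a \<and> ?eventually C a \<and> ?limits C a")
  proof (intro allI)
    fix C a
    show "?run C a \<longrightarrow> ?descent C a \<and> ?stationary C a \<and> ?convergent C a \<and> ?eventually C a \<and> ?limits C a"
    proof (rule impI)
      assume run: "?run C a"
      note ctxt = load budget run
      show "?descent C a \<and> ?stationary C a \<and> ?convergent C a \<and> ?eventually C a \<and> ?limits C a"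
      proof (intro conjI)
        show "?descent C a"
          using run_action_step_le[OF ctxt run_quantizer(4)[OF ctxt]]
            run_encoder_step_le[OF ctxt run_quantizer(3)[OF ctxt]] by blast
        show "?stationary C a"
          using run_stationary_iff[OF ctxt] by blast
        show "?convergent C a"
          by (rule run_convergent[OF ctxt])
        show "?eventually C a"
          using run_eventually_optimal[OF ctxt] by blast
        show "?limits C a"
          using run_limit_point[OF ctxt] by blast
      qed
    qed
  qed
  show "(\<exists>(M' :: (real ^ 2) measure) (T' :: real ^ 2 \<Rightarrow> real ^ 2) E' K' C a D b.
        random_load_vector M' T' \<and> 0 \<le> E' \<and> 1 \<le> K' \<and>
        alternating_run M' T' E' K' C a \<and> quantizer M' T' E' K' D b \<and>
        (\<forall>n. coordinatewise_optimum M' T' E' K' (C n) (a n) \<and>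
             distortion M' T' E' K' D b < distortion M' T' E' K' (C n) (a n)))"
    by (rule stationary_run_not_globally_optimal)
qed

end
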